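(* For every integer $n\ge 6$, with $k=\binom{n-3}{\lceil (n-3)/2\rceil}-\lceil n/2\rceil$, we have $h(n,k)>2^{n-2}+1$ (or $h(n,k)$ does not exist); i.e. there exists a set $\mathcal X$ of at least $2^{n-2}+1$ points in the plane in general position such that every convex $n$-gon with vertices in $\mathcal X$ contains more than $k$ points of $\mathcal X$ in its interior.
   Context: A finite planar point set is in general position if no three of its points are collinear. For integers $n\ge3$, $k\ge0$, $h(n,k)$ is the least positive integer (if it exists) such that every planar set $\mathcal X$ in general position with at least $h(n,k)$ points contains a convex $n$-gon $C$ with vertices in $\mathcal X$ whose interior contains at most $k$ points of $\mathcal X$. *)

theory Defs
  imports "HOL-Analysis.Analysis"
begin

definition general_position :: "(real^2) set \<Rightarrow> bool" where
  "general_position X \<longleftrightarrow>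
     (\<forall>a\<in>X. \<forall>b\<in>X. \<forall>c\<in>X. a \<noteq> b \<and> a \<noteq> c \<and> b \<noteq> c \<longrightarrow> \<not> collinear {a, b, c})"

definition convex_position :: "(real^2) set \<Rightarrow> bool" where
  "convex_position C \<longleftrightarrow> (\<forall>p\<in>C. p \<notin> convex hull (C - {p}))"

definition convex_ngon_in :: "nat \<Rightarrow> (real^2) set \<Rightarrow> (real^2) set \<Rightarrow> bool" where
  "convex_ngon_in n X C \<longleftrightarrow> C \<subseteq> X \<and> finite C \<and> card C = n \<and> convex_position C"

definition interior_points :: "(real^2) set \<Rightarrow> (real^2) set \<Rightarrow> nat" where
  "interior_points X C = card (X \<inter> interior (convex hull C))"

end

(* The Erdos-Szekeres set without convex n-gons is a chain X_0, ..., X_{n-2} of clusters, each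
   lying steeply below and to the right of the previous one, where X_i has binomial(n-2, i) points,
   no cap with more than i+1 and no cup with more than n-1-i points. A convex polygon that meets
   several clusters consists of a cap in the first, one point from each intermediate one and a cup in
   the last, hence has at most n-1 vertices. We replace the cluster X_m, m = ceil(n/2) - 1, by a
   set Y with one point more, which must contain caps or cups that are too long. Here
   Y = L + M + R, with the points of M above all lines from L to R, and both L + M and M + R
   respect the bounds for X_m; only cups that use both L and R can be too long. So
   every convex n-gon has a vertex in L, one in R and one in a cluster X_i with i < m, and the
   triangle of these three contains M, which has binomial(n-3, m-1) - m points. *)
theory Submission
  imports Defs
begin

section \<open>Orientations, caps and cups\<close>

text \<open>Twice the signed area of the triangle: positive for a left turn, negative for a right
  turn.\<close>

definition ori :: "real^2 \<Rightarrow> real^2 \<Rightarrow> real^2 \<Rightarrow> real" where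
  "ori a b c = (b$1 - a$1) * (c$2 - a$2) - (b$2 - a$2) * (c$1 - a$1)"

lemma ori_cycle: "ori b c a = ori a b c"
  by (simp add: ori_def algebra_simps)

lemma ori_swap: "ori b a c = - ori a b c"
  by (simp add: ori_def algebra_simps)

lemma collinear_imp_ori_0:
  assumes "collinear {a, b, c}"
  shows "ori a b c = 0"
proof -
  obtain u where u: "\<forall>x\<in>{a, b, c}. \<forall>y\<in>{a, b, c}. \<exists>k. x - y = k *\<^sub>R u"
    using assms unfolding collinear_def by blast
  obtain k where k: "b - a = k *\<^sub>R u" using u by blast
  obtain k' where k': "c - a = k' *\<^sub>R u" using u by blast
  have "b$i - a$i = k * u$i" "c$i - a$i = k' * u$i" for i
    using arg_cong[OF k, of "\<lambda>v. v$i"] arg_cong[OF k', of "\<lambda>v. v$i"] by simp_all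
  then show ?thesis by (simp add: ori_def)
qed

text \<open>The three orientations divided by their sum \<open>ori a b c\<close> are the barycentric
  coordinates of \<open>z\<close>, and all of them are positive.\<close>

lemma in_interior_triangle:
  assumes "ori z b c > 0" "ori a z c > 0" "ori a b z > 0"
  shows "z \<in> interior (convex hull {a, b, c})"
proof -
  define d where "d = ori a b c"
  have sum: "ori z b c + ori a z c + ori a b z = d"
    by (simp add: d_def ori_def algebra_simps)
  with assms have d: "d > 0" by linarith
  then have nc: "\<not> collinear {a, b, c}"
    using collinear_imp_ori_0[of a b c] by (auto simp: d_def)
  have eq: "ori z b c * a$i + ori a z c * b$i + ori a b z * c$i = d * z$i" for i :: 2
    using exhaust_2[of i] by (auto simp: d_def ori_def algebra_simps)
  let ?x = "ori z b c / d" and ?y = "ori a z c / d" and ?w = "ori a b z / d"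
  have "(?x *\<^sub>R a + ?y *\<^sub>R b + ?w *\<^sub>R c) $ i = z $ i" for i
  proof -
    have "(?x *\<^sub>R a + ?y *\<^sub>R b + ?w *\<^sub>R c) $ i
      = (ori z b c * a$i + ori a z c * b$i + ori a b z * c$i) / d"
      by (simp add: add_divide_distrib)
    then show ?thesis using eq[of i] d by simp
  qed
  then have v: "?x *\<^sub>R a + ?y *\<^sub>R b + ?w *\<^sub>R c = z"
    by (simp add: vec_eq_iff)
  have s1: "?x + ?y + ?w = 1"
    using sum d by (simp add: add_divide_distrib[symmetric])
  have "0 < ?x" "0 < ?y" "0 < ?w" using assms d by simp_all
  with v s1 show ?thesis
    unfolding interior_convex_hull_3_minimal[OF nc, simplified] by blast
qed

text \<open>A consequence of convex position that mentions orientations only, so that it survives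
  every map preserving \<open>ori\<close>. Counterclockwise triples suffice, since the corners range
  over all orders.\<close>

definition no_point_in_triangle :: "(real^2) set \<Rightarrow> bool" where
  "no_point_in_triangle C \<longleftrightarrow>
     (\<forall>a\<in>C. \<forall>b\<in>C. \<forall>c\<in>C. \<forall>z\<in>C. \<not> (ori z b c > 0 \<and> ori a z c > 0 \<and> ori a b z > 0))"

lemma convex_position_imp_no_point_in_triangle:
  assumes "convex_position C"
  shows "no_point_in_triangle C"
  unfolding no_point_in_triangle_def
proof (intro ballI notI)
  fix a b c z
  assume C: "a \<in> C" "b \<in> C" "c \<in> C" "z \<in> C"
    and o: "ori z b c > 0 \<and> ori a z c > 0 \<and> ori a b z > 0"
  have "z \<noteq> a" "z \<noteq> b" "z \<noteq> c"
    using o by (auto simp: ori_def)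
  then have "convex hull {a, b, c} \<subseteq> convex hull (C - {z})"
    using C by (intro hull_mono) auto
  moreover have "z \<in> convex hull {a, b, c}"
    using in_interior_triangle[of z b c a] o interior_subset by blast
  ultimately show False
    using assms C unfolding convex_position_def by blast
qed

text \<open>\<open>turning 1 D\<close> says that D is a cup and \<open>turning (-1) D\<close> that D is a cap.\<close>

definition turning :: "real \<Rightarrow> (real^2) set \<Rightarrow> bool" where
  "turning \<sigma> D \<longleftrightarrow> (\<forall>a\<in>D. \<forall>b\<in>D. \<forall>c\<in>D. a$1 < b$1 \<longrightarrow> b$1 < c$1 \<longrightarrow> \<sigma> * ori a b c > 0)"

text \<open>Distinct abscissas are demanded on top of general position because caps and cups refer
  to the order from left to right.\<close>

definition generic :: "(real^2) set \<Rightarrow> bool" where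
  "generic S \<longleftrightarrow> inj_on (\<lambda>p. p$1) S \<and>
     (\<forall>a\<in>S. \<forall>b\<in>S. \<forall>c\<in>S. a$1 < b$1 \<longrightarrow> b$1 < c$1 \<longrightarrow> ori a b c \<noteq> 0)"

definition chains_le :: "real \<Rightarrow> nat \<Rightarrow> (real^2) set \<Rightarrow> bool" where
  "chains_le \<sigma> k S \<longleftrightarrow> (\<forall>D\<subseteq>S. turning \<sigma> D \<longrightarrow> card D \<le> k)"

definition polygons_le :: "nat \<Rightarrow> (real^2) set \<Rightarrow> bool" where
  "polygons_le k S \<longleftrightarrow> (\<forall>C\<subseteq>S. no_point_in_triangle C \<longrightarrow> card C \<le> k)"

text \<open>In \<open>join 1 P Q\<close> the set Q lies to the right of P and so far below it that every line
  connecting P with Q has a smaller slope than all lines inside P and inside Q; in \<open>join (-1) P Q\<close>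
  it lies so far above that these slopes are larger.\<close>

definition join :: "real \<Rightarrow> (real^2) set \<Rightarrow> (real^2) set \<Rightarrow> bool" where
  "join \<sigma> P Q \<longleftrightarrow> (\<forall>p\<in>P. \<forall>q\<in>Q. p$1 < q$1) \<and>
     (\<forall>p\<in>P. \<forall>p'\<in>P. \<forall>q\<in>Q. p$1 < p'$1 \<longrightarrow> \<sigma> * ori p p' q < 0) \<and>
     (\<forall>p\<in>P. \<forall>q\<in>Q. \<forall>q'\<in>Q. q$1 < q'$1 \<longrightarrow> \<sigma> * ori p q q' > 0)"

section \<open>Subsets and general position\<close>

lemma turning_subset: "turning \<sigma> D \<Longrightarrow> E \<subseteq> D \<Longrightarrow> turning \<sigma> E"
  unfolding turning_def by blast

lemma no_point_in_triangle_subset: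
  "no_point_in_triangle D \<Longrightarrow> E \<subseteq> D \<Longrightarrow> no_point_in_triangle E"
  unfolding no_point_in_triangle_def by blast

lemma generic_subset: "generic S \<Longrightarrow> T \<subseteq> S \<Longrightarrow> generic T"
  unfolding generic_def by (meson inj_on_subset subsetD)

lemma chains_le_subset: "chains_le \<sigma> k S \<Longrightarrow> T \<subseteq> S \<Longrightarrow> k \<le> k' \<Longrightarrow> chains_le \<sigma> k' T"
  unfolding chains_le_def by (meson order.trans)

lemma polygons_le_subset: "polygons_le k S \<Longrightarrow> T \<subseteq> S \<Longrightarrow> k \<le> k' \<Longrightarrow> polygons_le k' T"
  unfolding polygons_le_def by (meson order.trans)

lemma join_subset: "join \<sigma> P Q \<Longrightarrow> P' \<subseteq> P \<Longrightarrow> Q' \<subseteq> Q \<Longrightarrow> join \<sigma> P' Q'"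
  unfolding join_def by blast

lemma join_disjoint: "join \<sigma> P Q \<Longrightarrow> P \<inter> Q = {}"
  unfolding join_def by fastforce

lemma generic_x_cases:
  assumes "generic S" "a \<in> S" "b \<in> S" "a \<noteq> b"
  obtains "a$1 < b$1" | "b$1 < a$1"
  using assms unfolding generic_def inj_on_def by (metis linorder_neqE)

lemma card_le_1I:
  assumes "generic D" "finite D" and "\<And>a b. a \<in> D \<Longrightarrow> b \<in> D \<Longrightarrow> a$1 < b$1 \<Longrightarrow> False"
  shows "card D \<le> 1"
proof -
  have "a = b" if "a \<in> D" "b \<in> D" for a b
    using generic_x_cases[OF assms(1) that] assms(3) that by blast
  then show ?thesis using assms(2) by (simp add: card_le_Suc0_iff_eq)
qed

lemma generic_imp_general_position:
  assumes "generic S"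
  shows "general_position S"
  unfolding general_position_def
proof (intro ballI impI notI)
  fix a b c
  assume S: "a \<in> S" "b \<in> S" "c \<in> S" and ne: "a \<noteq> b \<and> a \<noteq> c \<and> b \<noteq> c"
    and "collinear {a, b, c}"
  then have 0: "ori a b c = 0" using collinear_imp_ori_0 by blast
  then have all: "ori a c b = 0" "ori b a c = 0" "ori b c a = 0" "ori c a b = 0" "ori c b a = 0"
    by (simp_all add: ori_def algebra_simps)
  have x: "a$1 \<noteq> b$1" "a$1 \<noteq> c$1" "b$1 \<noteq> c$1"
    using assms S ne unfolding generic_def inj_on_def by blast+
  have g: "ori p q r \<noteq> 0" if "p \<in> S" "q \<in> S" "r \<in> S" "p$1 < q$1" "q$1 < r$1" for p q r
    using assms that unfolding generic_def by blast
  show False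
    using g[of a b c] g[of a c b] g[of b a c] g[of b c a] g[of c a b] g[of c b a] S x 0 all
    by linarith
qed

text \<open>As \<open>P\<close> lies to the left of \<open>Q\<close>, a mixed triple sorted by
  abscissa has the pattern PPQ or PQQ.\<close>

lemma generic_Un:
  assumes P: "generic P" and Q: "generic Q"
    and x: "\<And>p q. p \<in> P \<Longrightarrow> q \<in> Q \<Longrightarrow> p$1 < q$1"
    and PPQ: "\<And>p p' q. p \<in> P \<Longrightarrow> p' \<in> P \<Longrightarrow> q \<in> Q \<Longrightarrow> p$1 < p'$1 \<Longrightarrow> ori p p' q \<noteq> 0"
    and PQQ: "\<And>p q q'. p \<in> P \<Longrightarrow> q \<in> Q \<Longrightarrow> q' \<in> Q \<Longrightarrow> q$1 < q'$1 \<Longrightarrow> ori p q q' \<noteq> 0"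
  shows "generic (P \<union> Q)"
proof -
  have "inj_on (\<lambda>p. p$1) (P \<union> Q)"
    using P Q x unfolding generic_def inj_on_Un by fastforce
  moreover have "ori a b c \<noteq> 0"
    if "a \<in> P \<union> Q" "b \<in> P \<union> Q" "c \<in> P \<union> Q" and ab: "a$1 < b$1" and bc: "b$1 < c$1" for a b c
  proof -
    have PP: "ori a b c \<noteq> 0" if "a \<in> P" "b \<in> P" "c \<in> P"
      using P that ab bc unfolding generic_def by blast
    have QQ: "ori a b c \<noteq> 0" if "a \<in> Q" "b \<in> Q" "c \<in> Q"
      using Q that ab bc unfolding generic_def by blast
    have nba: "\<not> (b \<in> P \<and> a \<in> Q)" using x[of b a] ab by auto
    have ncb: "\<not> (c \<in> P \<and> b \<in> Q)" using x[of c b] bc by auto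
    show ?thesis
      using that(1-3) nba ncb PP QQ PPQ[of a b c] PQQ[of a b c] ab bc by blast
  qed
  ultimately show ?thesis unfolding generic_def by blast
qed

section \<open>Chains and polygons in a join\<close>

lemma generic_join:
  assumes "generic P" "generic Q" "join \<sigma> P Q"
  shows "generic (P \<union> Q)"
proof (rule generic_Un[OF assms(1,2)])
qed (use assms(3) in \<open>force simp: join_def\<close>)+

text \<open>Two points of \<open>P\<close> followed by one of \<open>Q\<close> turn the wrong way.
  So a chain that reaches \<open>Q\<close> uses at most one point of \<open>P\<close>, and only the
  bound of \<open>Q\<close> grows by one.\<close>

lemma chains_le_join_right:
  assumes j: "join \<sigma> P Q" and P: "generic P" "finite P" "chains_le \<sigma> k P" "k \<le> n"
    and Q: "finite Q" "chains_le \<sigma> l Q" "l + 1 \<le> n"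
  shows "chains_le \<sigma> n (P \<union> Q)"
  unfolding chains_le_def
proof (intro allI impI)
  fix D assume D: "D \<subseteq> P \<union> Q" "turning \<sigma> D"
  show "card D \<le> n"
  proof (cases "D \<inter> Q = {}")
    case True
    then have "D \<subseteq> P" using D by blast
    then show ?thesis using P D unfolding chains_le_def by (meson order.trans)
  next
    case False
    then obtain q where q: "q \<in> D" "q \<in> Q" by blast
    have "card (D \<inter> P) \<le> 1"
    proof (rule card_le_1I)
      show "generic (D \<inter> P)" using generic_subset[OF P(1)] by simp
      show "finite (D \<inter> P)" using P by simp
      fix a b assume ab: "a \<in> D \<inter> P" "b \<in> D \<inter> P" "a$1 < b$1"
      then have "b$1 < q$1" and neg: "\<sigma> * ori a b q < 0"
        using j q unfolding join_def by blast+
      then have "\<sigma> * ori a b q > 0"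
        using D(2) ab q unfolding turning_def by blast
      with neg show False by simp
    qed
    moreover have "card (D \<inter> Q) \<le> l"
      using Q(2) turning_subset[OF D(2)] unfolding chains_le_def by (meson inf_le1 inf_le2)
    moreover have "D = (D \<inter> P) \<union> (D \<inter> Q)" using D by blast
    ultimately show ?thesis using Q(3) card_Un_le[of "D \<inter> P" "D \<inter> Q"] by simp
  qed
qed

text \<open>The mirror image for the opposite sign: a point of \<open>P\<close> followed by two of
  \<open>Q\<close> turns the wrong way, so here the bound of \<open>P\<close> grows by one.\<close>

lemma chains_le_join_left:
  assumes j: "join \<sigma> P Q" and P: "finite P" "chains_le (- \<sigma>) k P" "k + 1 \<le> n"
    and Q: "generic Q" "finite Q" "chains_le (- \<sigma>) l Q" "l \<le> n"
  shows "chains_le (- \<sigma>) n (P \<union> Q)"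
  unfolding chains_le_def
proof (intro allI impI)
  fix D assume D: "D \<subseteq> P \<union> Q" "turning (- \<sigma>) D"
  show "card D \<le> n"
  proof (cases "D \<inter> P = {}")
    case True
    then have "D \<subseteq> Q" using D by blast
    then show ?thesis using Q D unfolding chains_le_def by (meson order.trans)
  next
    case False
    then obtain p where p: "p \<in> D" "p \<in> P" by blast
    have "card (D \<inter> Q) \<le> 1"
    proof (rule card_le_1I)
      show "generic (D \<inter> Q)" using generic_subset[OF Q(1)] by simp
      show "finite (D \<inter> Q)" using Q by simp
      fix a b assume ab: "a \<in> D \<inter> Q" "b \<in> D \<inter> Q" "a$1 < b$1"
      then have "p$1 < a$1" and pos: "\<sigma> * ori p a b > 0"
        using j p unfolding join_def by blast+
      then have "- \<sigma> * ori p a b > 0"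
        using D(2) ab p unfolding turning_def by blast
      with pos show False by simp
    qed
    moreover have "card (D \<inter> P) \<le> k"
      using P(2) turning_subset[OF D(2)] unfolding chains_le_def by (meson inf_le1 inf_le2)
    moreover have "D = (D \<inter> P) \<union> (D \<inter> Q)" using D by blast
    ultimately show ?thesis using P(3) card_Un_le[of "D \<inter> P" "D \<inter> Q"] by simp
  qed
qed

text \<open>For \<open>\<sigma> > 0\<close>: if a < b < c < q and a b c turns left while a b q, b c q and a c q turn
  right, then b lies in the triangle a c q.\<close>

lemma flank_right:
  assumes C: "no_point_in_triangle C" and D: "D \<subseteq> C" "generic D" and q: "q \<in> C"
    and \<sigma>: "\<sigma> \<noteq> 0"
    and neg: "\<And>a b. a \<in> D \<Longrightarrow> b \<in> D \<Longrightarrow> a$1 < b$1 \<Longrightarrow> \<sigma> * ori a b q < 0"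
  shows "turning (- \<sigma>) D"
  unfolding turning_def
proof (intro ballI impI)
  fix a b c assume d: "a \<in> D" "b \<in> D" "c \<in> D" and x: "a$1 < b$1" "b$1 < c$1"
  have n: "\<sigma> * ori a b q < 0" "\<sigma> * ori b c q < 0" "\<sigma> * ori a c q < 0"
    using neg d x by auto
  have "ori a b c \<noteq> 0" using D d x unfolding generic_def by blast
  moreover have "\<not> \<sigma> * ori a b c > 0"
  proof
    assume p: "\<sigma> * ori a b c > 0"
    have o: "ori b c q = - ori b q c" "ori a b c = - ori a c b" "ori a b q = - ori a q b"
      by (simp_all add: ori_def algebra_simps)
    have C': "a \<in> C" "b \<in> C" "c \<in> C" using d D by auto
    from \<sigma> consider "\<sigma> > 0" | "\<sigma> < 0" by linarith
    then show False
    proof cases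
      case 1
      then have "ori b q c > 0" "ori a b c > 0" "ori a q b > 0"
        using n p o by (auto simp: mult_less_0_iff zero_less_mult_iff)
      then show False using C C' q unfolding no_point_in_triangle_def by blast
    next
      case 2
      then have "ori b c q > 0" "ori a b q > 0" "ori a c b > 0"
        using n p o by (auto simp: mult_less_0_iff zero_less_mult_iff)
      then show False using C C' q unfolding no_point_in_triangle_def by blast
    qed
  qed
  ultimately show "- \<sigma> * ori a b c > 0" using \<sigma>
    by (metis linorder_neqE_linordered_idom mult_eq_0_iff mult_minus_left neg_0_less_iff_less)
qed

text \<open>Since \<open>flank_right\<close> sees \<open>q\<close> only through orientations and
  \<open>ori p a b = ori a b p\<close>, it applies to \<open>p\<close> with the sign
  \<open>- \<sigma>\<close>.\<close>

lemma flank_left: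
  assumes C: "no_point_in_triangle C" and D: "D \<subseteq> C" "generic D" and p: "p \<in> C"
    and \<sigma>: "\<sigma> \<noteq> 0"
    and pos: "\<And>a b. a \<in> D \<Longrightarrow> b \<in> D \<Longrightarrow> a$1 < b$1 \<Longrightarrow> \<sigma> * ori p a b > 0"
  shows "turning \<sigma> D"
proof -
  have "\<sigma> * ori a b p > 0" if "a \<in> D" "b \<in> D" "a$1 < b$1" for a b
    using pos[OF that] ori_cycle[of a b p] by simp
  then have "turning (- (- \<sigma>)) D"
    using \<sigma> by (intro flank_right[OF C D p]) auto
  then show ?thesis by simp
qed

text \<open>A polygon with points on both sides is flanked from each: for
  \<open>\<sigma> = 1\<close> its part in \<open>P\<close> is a cap and its part in \<open>Q\<close>
  is a cup.\<close>

lemma polygons_le_join: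
  assumes j: "join \<sigma> P Q" and \<sigma>: "\<sigma> \<noteq> 0"
    and P: "generic P" "polygons_le n P" "chains_le (- \<sigma>) k P"
    and Q: "generic Q" "polygons_le n Q" "chains_le \<sigma> l Q"
    and n: "k + l \<le> n"
  shows "polygons_le n (P \<union> Q)"
  unfolding polygons_le_def
proof (intro allI impI)
  fix C assume C: "C \<subseteq> P \<union> Q" "no_point_in_triangle C"
  consider "C \<subseteq> P" | "C \<subseteq> Q" | p q where "p \<in> C" "p \<in> P" "q \<in> C" "q \<in> Q"
    using C by blast
  then show "card C \<le> n"
  proof cases
    case 3
    have "turning (- \<sigma>) (C \<inter> P)"
      using j 3 generic_subset[OF P(1)] C(2)
      by (intro flank_right[OF _ _ _ _ \<sigma>, of C _ q]) (auto simp: join_def)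
    then have "card (C \<inter> P) \<le> k" using P(3) unfolding chains_le_def by blast
    moreover have "turning \<sigma> (C \<inter> Q)"
      using j 3 generic_subset[OF Q(1)] C(2)
      by (intro flank_left[OF _ _ _ _ \<sigma>, of C _ p]) (auto simp: join_def)
    then have "card (C \<inter> Q) \<le> l" using Q(3) unfolding chains_le_def by blast
    moreover have "C = (C \<inter> P) \<union> (C \<inter> Q)" using C by blast
    ultimately show ?thesis using n card_Un_le[of "C \<inter> P" "C \<inter> Q"] by simp
  qed (use P Q C in \<open>auto simp: polygons_le_def\<close>)
qed

section \<open>Placing a set far away from another one\<close>

text \<open>These maps preserve all notions introduced so far. Translations place the clusters, and
  vertical shears adjust their slopes.\<close>

definition order_embedding :: "(real^2 \<Rightarrow> real^2) \<Rightarrow> bool" where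
  "order_embedding f \<longleftrightarrow> inj f \<and> (\<forall>a b. f a$1 < f b$1 \<longleftrightarrow> a$1 < b$1) \<and>
     (\<forall>a b c. ori (f a) (f b) (f c) = ori a b c)"

text \<open>The parameters bound caps, cups and polygons, in this order.\<close>

definition small :: "nat \<Rightarrow> nat \<Rightarrow> nat \<Rightarrow> (real^2) set \<Rightarrow> bool" where
  "small a b e S \<longleftrightarrow> finite S \<and> generic S \<and> chains_le (-1) a S \<and> chains_le 1 b S \<and> polygons_le e S"

lemma small_image:
  assumes f: "order_embedding f" and S: "small a b e S"
  shows "small a b e (f ` S)"
proof -
  have inj: "inj f" and o: "ori (f a) (f b) (f c) = ori a b c" and x: "f a$1 < f b$1 \<longleftrightarrow> a$1 < b$1"
    for a b c using f unfolding order_embedding_def by auto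
  have card: "card (f ` D) = card D" for D
    using inj by (meson card_image inj_on_subset subset_UNIV)
  have t: "turning \<sigma> (f ` D) \<longleftrightarrow> turning \<sigma> D" for \<sigma> D
    by (simp add: turning_def o x)
  have tr: "no_point_in_triangle (f ` D) \<longleftrightarrow> no_point_in_triangle D" for D
    by (simp add: no_point_in_triangle_def o)
  have "generic (f ` S)"
  proof -
    have "a$1 = b$1" if "f a$1 = f b$1" for a b
      using that x[of a b] x[of b a] by linarith
    then have "inj_on (\<lambda>p. p$1) (f ` S)"
      using S unfolding small_def generic_def inj_on_def by blast
    then show ?thesis using S by (simp add: small_def generic_def o x)
  qed
  then show ?thesis
    using S unfolding small_def chains_le_def polygons_le_def all_subset_image
    by (simp add: card t tr)
qed

lemma order_embedding_translation: "order_embedding (\<lambda>p. p + v)"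
  unfolding order_embedding_def by (simp add: ori_def inj_def)

lemma order_embedding_shear: "order_embedding (\<lambda>p. vector [p$1, p$2 + c * p$1])"
  unfolding order_embedding_def
proof (intro conjI allI)
  show "inj (\<lambda>p :: real^2. vector [p$1, p$2 + c * p$1] :: real^2)"
    by (intro injI) (auto simp: vec_eq_iff forall_2)
qed (simp_all add: ori_def algebra_simps)

lemma slope_bound:
  fixes S :: "(real^2) set"
  assumes "finite S"
  obtains k where "k > 0"
    "\<And>a b. a \<in> S \<Longrightarrow> b \<in> S \<Longrightarrow> a$1 < b$1 \<Longrightarrow> \<bar>b$2 - a$2\<bar> < k * (b$1 - a$1)"
proof -
  have "\<forall>\<^sub>F k in at_top. a$1 < b$1 \<longrightarrow> \<bar>b$2 - a$2\<bar> < k * (b$1 - a$1)" for a b :: "real^2"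
  proof (cases "a$1 < b$1")
    case True
    have "\<forall>\<^sub>F k in at_top. k > \<bar>b$2 - a$2\<bar> / (b$1 - a$1)" by (rule eventually_gt_at_top)
    then show ?thesis by eventually_elim (use True in \<open>simp add: divide_less_eq\<close>)
  qed simp
  then have "\<forall>\<^sub>F k in at_top. k > 0 \<and> (\<forall>a\<in>S. \<forall>b\<in>S. a$1 < b$1 \<longrightarrow> \<bar>b$2 - a$2\<bar> < k * (b$1 - a$1))"
    using assms by (intro eventually_conj eventually_ball_finite ballI eventually_gt_at_top) auto
  then obtain k where "k > 0 \<and> (\<forall>a\<in>S. \<forall>b\<in>S. a$1 < b$1 \<longrightarrow> \<bar>b$2 - a$2\<bar> < k * (b$1 - a$1))"
    using eventually_happens' trivial_limit_at_top_linorder by blast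
  with that show ?thesis by blast
qed

text \<open>\<open>P\<close> is moved far to the left along a line of slope \<open>s\<close>. Lines
  from \<open>P\<close> to \<open>Q\<close> then have slopes close to \<open>s\<close>, so an
  orientation is decided by comparing \<open>s\<close> with the slope of the pair inside
  \<open>P\<close> or inside \<open>Q\<close>. For \<open>s < 0\<close> the motion also goes
  upwards.\<close>

lemma far_translation:
  fixes P Q :: "(real^2) set" and s :: real
  assumes "finite P" "finite Q"
  shows "\<exists>v. \<forall>p\<in>P. \<forall>q\<in>Q. (p + v)$1 < q$1 \<and> (s < 0 \<longrightarrow> q$2 < (p + v)$2) \<and>
      (\<forall>p'\<in>P. (p'$2 - p$2 < s * (p'$1 - p$1) \<longrightarrow> ori (p + v) (p' + v) q > 0) \<and>
              (p'$2 - p$2 > s * (p'$1 - p$1) \<longrightarrow> ori (p + v) (p' + v) q < 0)) \<and>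
      (\<forall>q'\<in>Q. (q'$2 - q$2 < s * (q'$1 - q$1) \<longrightarrow> ori (p + v) q q' < 0) \<and>
              (q'$2 - q$2 > s * (q'$1 - q$1) \<longrightarrow> ori (p + v) q q' > 0))"
proof -
  define v :: "real \<Rightarrow> real^2" where "v k = vector [- k, - s * k]" for k
  have v: "v k$1 = - k" "v k$2 = - s * k" for k by (simp_all add: v_def)
  \<comment> \<open>Each required inequality is affine in \<open>k\<close> with a positive leading
    coefficient, and there are finitely many of them.\<close>
  have lin: "\<forall>\<^sub>F k in at_top. a * k + b > 0" if "a > 0" for a b :: real
  proof -
    have "\<forall>\<^sub>F k in at_top. k > - b / a" by (rule eventually_gt_at_top)
    then show ?thesis by eventually_elim (use that in \<open>simp add: field_simps\<close>)
  qed
  have 1: "\<forall>\<^sub>F k in at_top. (p + v k)$1 < q$1" for p q :: "real^2"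
    using lin[of 1 "q$1 - p$1"] by (simp add: v algebra_simps)
  have 2: "\<forall>\<^sub>F k in at_top. s < 0 \<longrightarrow> q$2 < (p + v k)$2" for p q :: "real^2"
    using lin[of "- s" "p$2 - q$2"] by (cases "s < 0") (simp_all add: v algebra_simps)
  have PPQ: "ori (p + v k) (p' + v k) q = (s * (p'$1 - p$1) - (p'$2 - p$2)) * k + ori p p' q"
    for p p' q k by (simp add: v ori_def algebra_simps)
  have PQQ: "ori (p + v k) q q' = ((q'$2 - q$2) - s * (q'$1 - q$1)) * k + ori p q q'"
    for p q q' k by (simp add: v ori_def algebra_simps)
  have 3: "\<forall>\<^sub>F k in at_top. p'$2 - p$2 < s * (p'$1 - p$1) \<longrightarrow> ori (p + v k) (p' + v k) q > 0"
    for p p' q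
    using lin[of "s * (p'$1 - p$1) - (p'$2 - p$2)" "ori p p' q"]
    by (cases "p'$2 - p$2 < s * (p'$1 - p$1)") (simp_all add: PPQ)
  have 4: "\<forall>\<^sub>F k in at_top. p'$2 - p$2 > s * (p'$1 - p$1) \<longrightarrow> ori (p + v k) (p' + v k) q < 0"
    for p p' q
  proof (cases "p'$2 - p$2 > s * (p'$1 - p$1)")
    case True
    then have "\<forall>\<^sub>F k in at_top. ((p'$2 - p$2) - s * (p'$1 - p$1)) * k + - ori p p' q > 0"
      by (intro lin) simp
    then show ?thesis by eventually_elim (simp add: PPQ algebra_simps)
  qed simp
  have 5: "\<forall>\<^sub>F k in at_top. q'$2 - q$2 < s * (q'$1 - q$1) \<longrightarrow> ori (p + v k) q q' < 0" for p q q'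
  proof (cases "q'$2 - q$2 < s * (q'$1 - q$1)")
    case True
    then have "\<forall>\<^sub>F k in at_top. (s * (q'$1 - q$1) - (q'$2 - q$2)) * k + - ori p q q' > 0"
      by (intro lin) simp
    then show ?thesis by eventually_elim (simp add: PQQ algebra_simps)
  qed simp
  have 6: "\<forall>\<^sub>F k in at_top. q'$2 - q$2 > s * (q'$1 - q$1) \<longrightarrow> ori (p + v k) q q' > 0" for p q q'
    using lin[of "(q'$2 - q$2) - s * (q'$1 - q$1)" "ori p q q'"]
    by (cases "q'$2 - q$2 > s * (q'$1 - q$1)") (simp_all add: PQQ)
  have "\<forall>\<^sub>F k in at_top. \<forall>p\<in>P. \<forall>q\<in>Q. (p + v k)$1 < q$1 \<and> (s < 0 \<longrightarrow> q$2 < (p + v k)$2) \<and>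
      (\<forall>p'\<in>P. (p'$2 - p$2 < s * (p'$1 - p$1) \<longrightarrow> ori (p + v k) (p' + v k) q > 0) \<and>
              (p'$2 - p$2 > s * (p'$1 - p$1) \<longrightarrow> ori (p + v k) (p' + v k) q < 0)) \<and>
      (\<forall>q'\<in>Q. (q'$2 - q$2 < s * (q'$1 - q$1) \<longrightarrow> ori (p + v k) q q' < 0) \<and>
              (q'$2 - q$2 > s * (q'$1 - q$1) \<longrightarrow> ori (p + v k) q q' > 0))"
    using assms by (intro eventually_ball_finite eventually_conj ballI 1 2 3 4 5 6)
  then show ?thesis
    using eventually_happens' trivial_limit_at_top_linorder by blast
qed

text \<open>The direction of \<open>far_translation\<close> is taken steeper than every line inside
  the two sets, descending for \<open>\<sigma> = 1\<close>. The heights are recorded for the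
  construction of \<open>crown\<close>.\<close>

lemma join_translation:
  assumes "finite P" "finite Q" and \<sigma>: "\<sigma> = 1 \<or> \<sigma> = -1"
  shows "\<exists>v. join \<sigma> ((\<lambda>p. p + v) ` P) Q \<and> (\<sigma> = 1 \<longrightarrow> (\<forall>p\<in>P. \<forall>q\<in>Q. q$2 < (p + v)$2))"
proof -
  obtain k where k: "k > 0"
    "\<And>a b. a \<in> P \<union> Q \<Longrightarrow> b \<in> P \<union> Q \<Longrightarrow> a$1 < b$1 \<Longrightarrow> \<bar>b$2 - a$2\<bar> < k * (b$1 - a$1)"
    using slope_bound[of "P \<union> Q"] assms by blast
  obtain v where v: "\<forall>p\<in>P. \<forall>q\<in>Q. (p + v)$1 < q$1 \<and> (- \<sigma> * k < 0 \<longrightarrow> q$2 < (p + v)$2) \<and>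
      (\<forall>p'\<in>P. (p'$2 - p$2 < - \<sigma> * k * (p'$1 - p$1) \<longrightarrow> ori (p + v) (p' + v) q > 0) \<and>
              (p'$2 - p$2 > - \<sigma> * k * (p'$1 - p$1) \<longrightarrow> ori (p + v) (p' + v) q < 0)) \<and>
      (\<forall>q'\<in>Q. (q'$2 - q$2 < - \<sigma> * k * (q'$1 - q$1) \<longrightarrow> ori (p + v) q q' < 0) \<and>
              (q'$2 - q$2 > - \<sigma> * k * (q'$1 - q$1) \<longrightarrow> ori (p + v) q q' > 0))"
    using far_translation[OF assms(1,2), of "- \<sigma> * k"] by blast
  have steep: "if \<sigma> = 1 then b$2 - a$2 > - \<sigma> * k * (b$1 - a$1) else b$2 - a$2 < - \<sigma> * k * (b$1 - a$1)"
    if "a \<in> P \<union> Q" "b \<in> P \<union> Q" "a$1 < b$1" for a b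
    using k(2)[OF that] \<sigma> by (auto simp: abs_less_iff)
  have "join \<sigma> ((\<lambda>p. p + v) ` P) Q"
    unfolding join_def
  proof (intro conjI ballI impI)
    fix a b q assume "a \<in> (\<lambda>p. p + v) ` P" "b \<in> (\<lambda>p. p + v) ` P" "q \<in> Q" "a$1 < b$1"
    then obtain p p' where "a = p + v" "b = p' + v" "p \<in> P" "p' \<in> P" "p$1 < p'$1" by auto
    then show "\<sigma> * ori a b q < 0"
      using steep[of p p'] v \<sigma> \<open>q \<in> Q\<close> by auto
  next
    fix a q q' assume "a \<in> (\<lambda>p. p + v) ` P" "q \<in> Q" "q' \<in> Q" "q$1 < q'$1"
    then show "\<sigma> * ori a q q' > 0"
      using steep[of q q'] v \<sigma> by auto
  next
    fix a q assume "a \<in> (\<lambda>p. p + v) ` P" "q \<in> Q"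
    then show "a$1 < q$1" using v by auto
  qed
  moreover have "q$2 < (p + v)$2" if "\<sigma> = 1" "p \<in> P" "q \<in> Q" for p q
    using v that k(1) by simp
  ultimately show ?thesis by blast
qed

text \<open>Only the relative position matters, so the right set can be moved while the left one
  stays in place.\<close>

lemma join_translate_back:
  assumes "join \<sigma> ((\<lambda>p. p + v) ` P) Q"
  shows "join \<sigma> P ((\<lambda>p. p + - v) ` Q)"
proof -
  have "ori (p + v) (p' + v) q = ori p p' (q + - v)" "ori (p + v) q q' = ori p (q + - v) (q' + - v)"
    for p p' q q' by (simp_all add: ori_def algebra_simps)
  moreover have "(p + v)$1 < q$1 \<longleftrightarrow> p$1 < (q + - v)$1" for p q :: "real^2"
    by (simp add: algebra_simps)
  ultimately show ?thesis using assms by (simp add: join_def)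
qed

section \<open>Erdos-Szekeres sets\<close>

lemma small_mono: "small a b e S \<Longrightarrow> a \<le> a' \<Longrightarrow> b \<le> b' \<Longrightarrow> e \<le> e' \<Longrightarrow> small a' b' e' S"
  unfolding small_def using chains_le_subset polygons_le_subset by blast

text \<open>Below and to the right: caps of \<open>P\<close> and cups of \<open>Q\<close> can gain
  one point, and a mixed polygon is a cap of \<open>P\<close> with a cup of
  \<open>Q\<close>.\<close>

lemma small_join_down:
  assumes j: "join 1 P Q" and P: "small a b e P" and Q: "small c d f Q"
    and n: "a + 1 \<le> x" "c \<le> x" "b \<le> y" "d + 1 \<le> y" "e \<le> z" "f \<le> z" "a + d \<le> z"
  shows "small x y z (P \<union> Q)"
proof -
  have "chains_le (-1) x (P \<union> Q)"
    using chains_le_join_left[OF j, of a x c] P Q n by (simp add: small_def)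
  moreover have "chains_le 1 y (P \<union> Q)"
    using chains_le_join_right[OF j, of b y d] P Q n by (simp add: small_def)
  moreover have "polygons_le z (P \<union> Q)"
    using polygons_le_join[OF j, of z a d] P Q n
    by (simp add: small_def) (metis polygons_le_subset subset_refl)
  ultimately show ?thesis using P Q generic_join[OF _ _ j] by (simp add: small_def)
qed

text \<open>Above and to the right the roles of caps and cups are exchanged.\<close>

lemma small_join_up:
  assumes j: "join (-1) P Q" and P: "small a b e P" and Q: "small c d f Q"
    and n: "a \<le> x" "c + 1 \<le> x" "b + 1 \<le> y" "d \<le> y" "e \<le> z" "f \<le> z" "b + c \<le> z"
  shows "small x y z (P \<union> Q)"
proof -
  have "chains_le (-1) x (P \<union> Q)"
    using chains_le_join_right[OF j, of a x c] P Q n by (simp add: small_def)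
  moreover have "chains_le 1 y (P \<union> Q)"
    using chains_le_join_left[OF j, of b y d] P Q n by (simp add: small_def)
  moreover have "polygons_le z (P \<union> Q)"
    using polygons_le_join[OF j, of z b c] P Q n
    by (simp add: small_def) (metis polygons_le_subset subset_refl)
  ultimately show ?thesis using P Q generic_join[OF _ _ j] by (simp add: small_def)
qed

lemma card_translation: "card ((\<lambda>p. p + v) ` S) = card S" for v :: "real^2"
  by (simp add: card_image)

text \<open>The recursion is Pascal's rule: the set for \<open>(a, b - 1)\<close> is joined upwards
  with the set for \<open>(a - 1, b)\<close>.\<close>

lemma erdos_szekeres_cups_caps:
  "\<exists>S. card S = (a + b) choose a \<and> small (a + 1) (b + 1) (a + b + 1) S"
proof (induction "a + b" arbitrary: a b rule: less_induct)
  case less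
  show ?case
  proof (cases "a = 0 \<or> b = 0")
    case True
    have "card D \<le> 1" if "D \<subseteq> {0 :: real^2}" for D
      using card_mono[OF _ that] by simp
    then have "small 1 1 1 {0}"
      by (simp add: small_def generic_def chains_le_def polygons_le_def)
    then have "small (a + 1) (b + 1) (a + b + 1) {0}" by (rule small_mono) simp_all
    then show ?thesis
      using True by (intro exI[of _ "{0}"]) auto
  next
    case False
    then obtain c d where c: "a = Suc c" and d: "b = Suc d" by (metis not0_implies_Suc)
    obtain P where P: "card P = (a + d) choose a" "small (a + 1) (d + 1) (a + d + 1) P"
      using less[of a d] d by auto
    obtain Q where Q: "card Q = (c + b) choose c" "small (c + 1) (b + 1) (c + b + 1) Q"
      using less[of c b] c by auto
    obtain v where v: "join (-1) ((\<lambda>p. p + v) ` P) Q"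
      using join_translation[of P Q "-1"] P Q by (auto simp: small_def)
    let ?P = "(\<lambda>p. p + v) ` P"
    have P': "small (a + 1) (d + 1) (a + d + 1) ?P"
      by (rule small_image[OF order_embedding_translation P(2)])
    have "small (a + 1) (b + 1) (a + b + 1) (?P \<union> Q)"
      by (rule small_join_up[OF v P' Q(2)]) (simp_all add: c d)
    moreover have "card (?P \<union> Q) = (a + b) choose a"
      using join_disjoint[OF v] P' Q P(1) card_Un_disjoint[of ?P Q]
      by (simp add: small_def card_translation c d)
    ultimately show ?thesis by blast
  qed
qed

text \<open>A vertical shear by more than every slope of \<open>S\<close> gives all its lines the
  same sign of slope and keeps all orientations.\<close>

lemma small_shear:
  assumes S: "small a b e S"
  shows "\<exists>T. card T = card S \<and> small a b e T \<and> (\<forall>p\<in>T. \<forall>q\<in>T. p$1 < q$1 \<longrightarrow> q$2 < p$2)"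
    and "\<exists>T. card T = card S \<and> small a b e T \<and> (\<forall>p\<in>T. \<forall>q\<in>T. p$1 < q$1 \<longrightarrow> p$2 < q$2)"
proof -
  obtain k where k: "k > 0"
    "\<And>a b. a \<in> S \<Longrightarrow> b \<in> S \<Longrightarrow> a$1 < b$1 \<Longrightarrow> \<bar>b$2 - a$2\<bar> < k * (b$1 - a$1)"
    using slope_bound S unfolding small_def by blast
  define f :: "real \<Rightarrow> real^2 \<Rightarrow> real^2" where "f c p = vector [p$1, p$2 + c * p$1]" for c p
  have f: "order_embedding (f c)" for c
    using order_embedding_shear[of c] unfolding f_def .
  have card: "card (f c ` S) = card S" for c
    using f by (meson card_image inj_on_subset order_embedding_def subset_UNIV)
  have "q$2 - k * q$1 < p$2 - k * p$1" "p$2 + k * p$1 < q$2 + k * q$1"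
    if "p \<in> S" "q \<in> S" "p$1 < q$1" for p q
    using k(2)[OF that] right_diff_distrib[of k "q$1" "p$1"] by linarith+
  then have mono: "\<forall>p\<in>f (- k) ` S. \<forall>q\<in>f (- k) ` S. p$1 < q$1 \<longrightarrow> q$2 < p$2"
    "\<forall>p\<in>f k ` S. \<forall>q\<in>f k ` S. p$1 < q$1 \<longrightarrow> p$2 < q$2"
    by (simp_all add: f_def)
  show "\<exists>T. card T = card S \<and> small a b e T \<and> (\<forall>p\<in>T. \<forall>q\<in>T. p$1 < q$1 \<longrightarrow> q$2 < p$2)"
    by (intro exI[of _ "f (- k) ` S"] conjI card small_image[OF f S] mono)
  show "\<exists>T. card T = card S \<and> small a b e T \<and> (\<forall>p\<in>T. \<forall>q\<in>T. p$1 < q$1 \<longrightarrow> p$2 < q$2)"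
    by (intro exI[of _ "f k ` S"] conjI card small_image[OF f S] mono)
qed

text \<open>With \<open>N = n - 2\<close>, the set \<open>U\<close> consists of the clusters with
  indices from \<open>i\<close> to \<open>j - 1\<close>, placed one after another to the left of
  \<open>B\<close>. The bounds are stated for subsets \<open>B'\<close>, because the enlarged
  cluster violates the cup bound while suitable parts of it respect it.\<close>

lemma erdos_szekeres_extension:
  assumes "finite B" "generic B" and ij: "i \<le> j" "j \<le> N + 1"
  shows "\<exists>U. finite U \<and> card U = (\<Sum>t=i..<j. N choose t) \<and> generic (U \<union> B) \<and>
    (\<forall>u\<in>U. \<forall>b\<in>B. u$1 < b$1) \<and>
    (\<forall>u\<in>U. \<forall>b\<in>B. \<forall>b'\<in>B. b$1 < b'$1 \<longrightarrow> ori u b b' > 0) \<and>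
    (\<forall>B'\<subseteq>B. chains_le 1 (N + 1 - j) B' \<longrightarrow> polygons_le (N + 1) B' \<longrightarrow>
       chains_le 1 (N + 1 - i) (U \<union> B') \<and> polygons_le (N + 1) (U \<union> B'))"
  using ij(1)
proof (induction i rule: inc_induct)
  case base
  show ?case using assms by (intro exI[of _ "{}"]) simp
next
  case (step i)
  then obtain U where U: "finite U" "card U = (\<Sum>t=Suc i..<j. N choose t)" "generic (U \<union> B)"
    "\<forall>u\<in>U. \<forall>b\<in>B. u$1 < b$1"
    "\<forall>u\<in>U. \<forall>b\<in>B. \<forall>b'\<in>B. b$1 < b'$1 \<longrightarrow> ori u b b' > 0"
    "\<forall>B'\<subseteq>B. chains_le 1 (N + 1 - j) B' \<longrightarrow> polygons_le (N + 1) B' \<longrightarrow>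
       chains_le 1 (N + 1 - Suc i) (U \<union> B') \<and> polygons_le (N + 1) (U \<union> B')"
    by blast
  have iN: "i \<le> N" using step ij by simp
  obtain X where X: "card X = N choose i" "small (i + 1) (N - i + 1) (N + 1) X"
    using erdos_szekeres_cups_caps[of i "N - i"] iN by auto
  have fin: "finite X" "finite (U \<union> B)" using X U assms by (simp_all add: small_def)
  obtain v where v: "join 1 ((\<lambda>p. p + v) ` X) (U \<union> B)"
    using join_translation[OF fin, of 1] by blast
  let ?X = "(\<lambda>p. p + v) ` X"
  have X': "small (i + 1) (N - i + 1) (N + 1) ?X"
    by (rule small_image[OF order_embedding_translation X(2)])
  have "finite (?X \<union> U)" using X' U by (simp add: small_def)
  moreover have "card (?X \<union> U) = (\<Sum>t=i..<j. N choose t)"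
  proof -
    have "?X \<inter> U = {}" using join_disjoint[OF v] by blast
    then have "card (?X \<union> U) = card ?X + card U"
      using X' U by (intro card_Un_disjoint) (simp_all add: small_def)
    then show ?thesis
      using X U step by (simp add: card_translation sum.atLeast_Suc_lessThan)
  qed
  moreover have "generic (?X \<union> U \<union> B)"
    using generic_join[OF _ U(3) v] X' by (simp add: small_def Un_assoc)
  moreover have "\<forall>u\<in>?X \<union> U. \<forall>b\<in>B. u$1 < b$1"
    using U(4) v unfolding join_def by blast
  moreover have "\<forall>u\<in>?X \<union> U. \<forall>b\<in>B. \<forall>b'\<in>B. b$1 < b'$1 \<longrightarrow> ori u b b' > 0"
    using U(5) v unfolding join_def by auto
  moreover have "chains_le 1 (N + 1 - i) (?X \<union> U \<union> B') \<and> polygons_le (N + 1) (?X \<union> U \<union> B')"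
    if B': "B' \<subseteq> B" "chains_le 1 (N + 1 - j) B'" "polygons_le (N + 1) B'" for B'
  proof -
    have "generic (U \<union> B')" using B' by (intro generic_subset[OF U(3)]) auto
    moreover have "finite (U \<union> B')" using B' U(1) assms(1) finite_subset by blast
    ultimately have Q: "chains_le 1 (N - i) (U \<union> B')" "polygons_le (N + 1) (U \<union> B')"
      "finite (U \<union> B')" "generic (U \<union> B')"
      using U(6) B' by simp_all
    have j: "join 1 ?X (U \<union> B')"
      using v by (rule join_subset) (use B' in auto)
    have "chains_le 1 (N + 1 - i) (?X \<union> (U \<union> B'))"
      using chains_le_join_right[OF j, of "N - i + 1" "N + 1 - i" "N - i"] X' Q iN
      by (simp add: small_def)
    \<comment> \<open>A mixed polygon has at most \<open>i + 1\<close> points in a cap of the new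
      cluster and at most \<open>N - i\<close> in a cup of the rest.\<close>
    moreover have "polygons_le (N + 1) (?X \<union> (U \<union> B'))"
      using polygons_le_join[OF j, of "N + 1" "i + 1" "N - i"] X' Q iN
      by (simp add: small_def)
    ultimately show ?thesis by (simp add: Un_assoc)
  qed
  ultimately show ?case by (intro exI[of _ "?X \<union> U"]) simp
qed

section \<open>The enlarged cluster\<close>

text \<open>M is a chain of small Erdos-Szekeres sets that descends to R. All lines inside M and between M
  and R have negative slope, while all lines inside R have positive slope; so for a point l that
  is far away to the left on the horizontal, \<open>insert l M\<close> bends right at each point of M and
  \<open>insert l R\<close> bends left at each point of R. The last condition says that a cap of M which can
  be prolonged to a point of R stays inside one of the sets of the chain.\<close>

definition crown :: "nat \<Rightarrow> nat \<Rightarrow> (real^2) set \<Rightarrow> (real^2) set \<Rightarrow> bool" where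
  "crown m u M R \<longleftrightarrow> card M + m = (m + u) choose (m - 1) \<and> card R = m + 1 \<and>
     small (m + 1) (u + 2) (m + u + 2) (M \<union> R) \<and> chains_le (-1) m M \<and> chains_le 1 2 R \<and>
     (\<forall>z\<in>M. \<forall>r\<in>R. z$1 < r$1 \<and> r$2 < z$2) \<and>
     (\<forall>z\<in>M. \<forall>z'\<in>M. z$1 < z'$1 \<longrightarrow> z'$2 < z$2) \<and>
     (\<forall>r\<in>R. \<forall>r'\<in>R. r$1 < r'$1 \<longrightarrow> r$2 < r'$2) \<and>
     (\<forall>E\<subseteq>M. \<forall>r\<in>R. turning (-1) E \<longrightarrow>
        (\<forall>a\<in>E. \<forall>b\<in>E. a$1 < b$1 \<longrightarrow> ori a b r < 0) \<longrightarrow> card E \<le> m - 1)"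

lemma crown_visible:
  assumes "crown m u M R" "E \<subseteq> M" "r \<in> R" "turning (-1) E"
    and "\<forall>a\<in>E. \<forall>b\<in>E. a$1 < b$1 \<longrightarrow> ori a b r < 0"
  shows "card E \<le> m - 1"
proof -
  have "\<forall>E\<subseteq>M. \<forall>r\<in>R. turning (-1) E \<longrightarrow>
      (\<forall>a\<in>E. \<forall>b\<in>E. a$1 < b$1 \<longrightarrow> ori a b r < 0) \<longrightarrow> card E \<le> m - 1"
    using assms(1) unfolding crown_def by (elim conjE)
  then show ?thesis using assms(2-) by blast
qed

text \<open>Induction on \<open>u\<close>: at each step a descending set with caps of at most
  \<open>m - 1\<close> points is placed steeply above and to the left. Its size
  \<open>(m + u) choose (m - 2)\<close> is the missing term of Pascal's rule. The start is an empty
  \<open>M\<close> and an ascending \<open>R\<close>.\<close>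

lemma crown_exists:
  assumes m: "m \<ge> 2"
  shows "\<exists>M R. crown m u M R"
proof (induction u)
  case 0
  obtain S where "card S = (m + 1) choose m" "small (m + 1) 2 (m + 2) S"
    using erdos_szekeres_cups_caps[of m 1] by (auto simp: numeral_2_eq_2)
  then obtain R where R: "card R = m + 1" "small (m + 1) 2 (m + 2) R"
    "\<forall>p\<in>R. \<forall>q\<in>R. p$1 < q$1 \<longrightarrow> p$2 < q$2"
    using small_shear(2)[of "m + 1" 2 "m + 2" S] by auto
  have "m choose (m - 1) = m"
    using m by (cases m) simp_all
  then have "crown m 0 {} R"
    using R by (auto simp: crown_def small_def chains_le_def)
  then show ?case by blast
next
  case (Suc u)
  then obtain M R where c: "crown m u M R" by blast
  obtain k where k: "m = k + 2" using m by (metis add.commute le_Suc_ex)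
  obtain S where "card S = (m + u) choose k" "small (k + 1) (u + 3) (k + u + 3) S"
    using erdos_szekeres_cups_caps[of k "u + 2"] by (auto simp: k numeral_2_eq_2 numeral_3_eq_3)
  then obtain Z where Z: "card Z = (m + u) choose k" "small (k + 1) (u + 3) (k + u + 3) Z"
    "\<forall>p\<in>Z. \<forall>q\<in>Z. p$1 < q$1 \<longrightarrow> q$2 < p$2"
    using small_shear(1)[of "k + 1" "u + 3" "k + u + 3" S] by auto
  have T: "small (m + 1) (u + 2) (m + u + 2) (M \<union> R)" using c by (simp add: crown_def)
  have fin: "finite Z" "finite (M \<union> R)" using Z T by (simp_all add: small_def)
  obtain v where j: "join 1 ((\<lambda>p. p + v) ` Z) (M \<union> R)"
    and y: "\<forall>p\<in>Z. \<forall>q\<in>M \<union> R. q$2 < (p + v)$2"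
    using join_translation[OF fin, of 1] by blast
  define X where "X = (\<lambda>p. p + v) ` Z"
  have X: "card X = (m + u) choose k" "small (k + 1) (u + 3) (k + u + 3) X"
    "\<forall>p\<in>X. \<forall>q\<in>X. p$1 < q$1 \<longrightarrow> q$2 < p$2" "\<forall>p\<in>X. \<forall>q\<in>M \<union> R. q$2 < p$2"
    using Z y small_image[OF order_embedding_translation Z(2)]
    by (auto simp: X_def card_translation)
  note j = j[folded X_def]
  have jM: "join 1 X M" using j by (rule join_subset) auto
  have M: "finite M" "generic M" "chains_le (-1) m M"
    using c T generic_subset[of "M \<union> R" M] by (simp_all add: crown_def small_def)
  have "small (m + 1) (u + 3) (m + u + 3) (X \<union> (M \<union> R))"
    by (rule small_join_down[OF j X(2) T]) (simp_all add: k)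
  moreover have "chains_le (-1) m (X \<union> M)"
    using chains_le_join_left[OF jM, of "k + 1" m m] X(2) M by (simp add: small_def k)
  moreover have "card (X \<union> M) + m = (m + Suc u) choose (m - 1)"
  proof -
    have "card (X \<union> M) = card X + card M"
      using X(2) M join_disjoint[OF jM] by (intro card_Un_disjoint) (simp_all add: small_def)
    then have "card (X \<union> M) + m = ((m + u) choose k) + ((m + u) choose Suc k)"
      using X(1) c by (simp add: crown_def k)
    then show ?thesis by (simp add: k)
  qed
  moreover have "\<forall>z\<in>X \<union> M. \<forall>r\<in>R. z$1 < r$1 \<and> r$2 < z$2"
    using c X(4) j by (auto simp: crown_def join_def)
  moreover have "\<forall>z\<in>X \<union> M. \<forall>z'\<in>X \<union> M. z$1 < z'$1 \<longrightarrow> z'$2 < z$2"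
  proof (intro ballI impI)
    fix z z' assume z: "z \<in> X \<union> M" "z' \<in> X \<union> M" "z$1 < z'$1"
    have "\<not> (z \<in> M \<and> z' \<in> X)"
      using jM z(3) unfolding join_def by (meson order_less_asym)
    moreover have "\<forall>z\<in>M. \<forall>z'\<in>M. z$1 < z'$1 \<longrightarrow> z'$2 < z$2"
      using c by (simp add: crown_def)
    ultimately show "z'$2 < z$2" using z X(3,4) by blast
  qed
  moreover have "card E \<le> m - 1"
    if E: "E \<subseteq> X \<union> M" "turning (-1) E" and r: "r \<in> R"
      "\<forall>a\<in>E. \<forall>b\<in>E. a$1 < b$1 \<longrightarrow> ori a b r < 0" for E r
  proof -
    consider "E \<subseteq> X" | "E \<subseteq> M" | x z where "x \<in> E" "x \<in> X" "z \<in> E" "z \<in> M"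
      using E by blast
    then show ?thesis
    proof cases
      case 1
      then show ?thesis using X(2) E(2) by (simp add: small_def chains_le_def k)
    next
      case 2
      then show ?thesis using crown_visible[OF c _ r(1) E(2)] r(2) by blast
    next
      case 3
      \<comment> \<open>From the new cluster through the old \<open>M\<close> to \<open>R\<close>
        every triple turns left, so a cap visible from \<open>r\<close> cannot mix the two.\<close>
      have "z$1 < r$1" using c 3 r by (simp add: crown_def)
      then have "ori x z r > 0" "x$1 < z$1" using j 3 r by (simp_all add: join_def)
      then show ?thesis using r(2) 3 by fastforce
    qed
  qed
  ultimately have "crown m (Suc u) (X \<union> M) R"
    using c by (auto simp: crown_def Un_assoc numeral_3_eq_3)
  then show ?case by blast
qed

text \<open>One point more than an Erdos-Szekeres set for (m + 1)-caps and (u + 2)-cups can have. The longer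
  cups, which therefore exist, join points of L with points of R and pass below the whole of M.\<close>

definition gadget :: "nat \<Rightarrow> nat \<Rightarrow> (real^2) set \<Rightarrow> (real^2) set \<Rightarrow> (real^2) set \<Rightarrow> bool" where
  "gadget m u L M R \<longleftrightarrow> finite (L \<union> M \<union> R) \<and> generic (L \<union> M \<union> R) \<and>
     card (L \<union> M \<union> R) = ((m + u + 1) choose m) + 1 \<and> card M + m = (m + u) choose (m - 1) \<and>
     chains_le (-1) (m + 1) (L \<union> M \<union> R) \<and> polygons_le (m + u + 2) (L \<union> M \<union> R) \<and>
     chains_le 1 (u + 2) (M \<union> R) \<and> chains_le 1 (u + 2) (L \<union> M) \<and>
     (\<forall>l\<in>L. \<forall>z\<in>M. \<forall>r\<in>R. l$1 < z$1 \<and> z$1 < r$1 \<and> ori l z r < 0)"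

text \<open>\<open>L\<close> is a descending Erdos-Szekeres set moved far to the left along the
  horizontal, next to a crown. Mixed orientations depend only on whether a line inside a part
  ascends or descends, and Pascal's rule gives the size, where the surplus point comes from
  \<open>card R = m + 1\<close>.\<close>

lemma gadget_exists:
  assumes m: "m \<ge> 2"
  shows "\<exists>L M R. gadget m u L M R"
proof -
  obtain M R where c: "crown m u M R" using crown_exists[OF m] by blast
  obtain S where "card S = (m + u) choose m" "small (m + 1) (u + 1) (m + u + 1) S"
    using erdos_szekeres_cups_caps[of m u] by auto
  then obtain L\<^sub>0 where L0: "card L\<^sub>0 = (m + u) choose m" "small (m + 1) (u + 1) (m + u + 1) L\<^sub>0"
    "\<forall>p\<in>L\<^sub>0. \<forall>q\<in>L\<^sub>0. p$1 < q$1 \<longrightarrow> q$2 < p$2"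
    using small_shear(1)[of "m + 1" "u + 1" "m + u + 1" S] by auto
  have T: "small (m + 1) (u + 2) (m + u + 2) (M \<union> R)" using c by (simp add: crown_def)
  have fin: "finite L\<^sub>0" "finite (M \<union> R)" using L0 T by (simp_all add: small_def)
  \<comment> \<open>The slope is 0: lines from \<open>L\<close> to the crown are almost
    horizontal.\<close>
  obtain v where v: "\<forall>p\<in>L\<^sub>0. \<forall>q\<in>M \<union> R. (p + v)$1 < q$1 \<and>
      (\<forall>p'\<in>L\<^sub>0. p'$2 - p$2 < 0 \<longrightarrow> ori (p + v) (p' + v) q > 0) \<and>
      (\<forall>q'\<in>M \<union> R. (q'$2 - q$2 < 0 \<longrightarrow> ori (p + v) q q' < 0) \<and>
              (q'$2 - q$2 > 0 \<longrightarrow> ori (p + v) q q' > 0))"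
    using far_translation[OF fin, of 0] unfolding mult_zero_left by blast
  define L where "L = (\<lambda>p. p + v) ` L\<^sub>0"
  have L: "card L = (m + u) choose m" "small (m + 1) (u + 1) (m + u + 1) L"
    using L0 small_image[OF order_embedding_translation L0(2)]
    by (simp_all add: L_def card_translation)
  have xLT: "l$1 < t$1" if "l \<in> L" "t \<in> M \<union> R" for l t
    using v that by (auto simp: L_def)
  have llt: "ori l l' t > 0" if "l \<in> L" "l' \<in> L" "l$1 < l'$1" "t \<in> M \<union> R" for l l' t
    using v L0(3) that by (auto simp: L_def)
  have xMR: "z$1 < r$1" if "z \<in> M" "r \<in> R" for z r
    using c that by (simp add: crown_def)
  have lzt: "ori l z t < 0" if "l \<in> L" "z \<in> M" "t \<in> M \<union> R" "z$1 < t$1" for l z t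
  proof -
    have "t$2 < z$2" using c that(2-4) by (auto simp: crown_def)
    then show ?thesis using v that(1-3) by (auto simp: L_def)
  qed
  have lrr: "ori l r r' > 0" if "l \<in> L" "r \<in> R" "r' \<in> R" "r$1 < r'$1" for l r r'
  proof -
    have "r$2 < r'$2" using c that(2-4) by (simp add: crown_def)
    then show ?thesis using v that(1-3) by (auto simp: L_def)
  qed
  have lrt: "t \<in> R" if "r \<in> R" "t \<in> M \<union> R" "r$1 < t$1" for r t
    using xMR[of t r] that by auto
  \<comment> \<open>All lines inside \<open>L\<close> and \<open>M\<close> descend, so relative to
    them \<open>M\<close> counts as far above \<open>L\<close>. The ascending lines of
    \<open>R\<close> prevent the same for \<open>R\<close>.\<close>
  have jLM: "join (-1) L M" using xLT llt lzt by (simp add: join_def)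
  have gen: "generic (L \<union> (M \<union> R))"
  proof (rule generic_Un)
    show "ori l a b \<noteq> 0" if "l \<in> L" "a \<in> M \<union> R" "b \<in> M \<union> R" "a$1 < b$1" for l a b
      using that lzt[of l a b] lrr[of l a b] lrt[of a b] by fastforce
  qed (use L T xLT llt in \<open>force simp: small_def\<close>)+
  have genL: "generic L" and genM: "generic M" and genR: "generic R"
    using gen generic_subset by blast+
  have fL: "finite L" and fM: "finite M" and fR: "finite R"
    using L T by (simp_all add: small_def)
  have cupMR: "chains_le 1 (u + 2) (M \<union> R)" and capMR: "chains_le (-1) (m + 1) (M \<union> R)"
    and polMR: "polygons_le (m + u + 2) (M \<union> R)"
    using T by (simp_all add: small_def)
  have capM: "chains_le (-1) m M" and cupM: "chains_le 1 (u + 2) M"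
    using c chains_le_subset[OF cupMR] by (simp_all add: crown_def)
  have cupLM: "chains_le 1 (u + 2) (L \<union> M)"
    using chains_le_join_left[OF jLM, of "u + 1" "u + 2" "u + 2"] L fM genM cupM
    by (simp add: small_def)
  have capLM: "chains_le (-1) (m + 1) (L \<union> M)"
    using chains_le_join_right[OF jLM, of "m + 1" "m + 1" m] L fM capM
    by (simp add: small_def)
  have polLM: "polygons_le (m + u + 2) (L \<union> M)"
  proof (rule polygons_le_join[OF jLM, of _ "u + 1" m])
    show "polygons_le (m + u + 2) L"
      using L polygons_le_subset[of "m + u + 1" L L "m + u + 2"] by (simp add: small_def)
    show "polygons_le (m + u + 2) M"
      using polygons_le_subset[OF polMR] by simp
  qed (use L genL genM capM in \<open>simp_all add: small_def\<close>)
  have visible: "card E \<le> m - 1"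
    if "E \<subseteq> M" "r \<in> R" "turning (-1) E" "\<And>a b. a \<in> E \<Longrightarrow> b \<in> E \<Longrightarrow> a$1 < b$1 \<Longrightarrow> ori a b r < 0"
    for E r
    using crown_visible[OF c that(1-3)] that(4) by blast
  have split3: "card D \<le> card (D \<inter> L) + card (D \<inter> M) + card (D \<inter> R)" if "D \<subseteq> L \<union> M \<union> R" for D
  proof -
    have "D = (D \<inter> L \<union> D \<inter> M) \<union> D \<inter> R" using that by blast
    then show ?thesis
      using card_Un_le[of "D \<inter> L \<union> D \<inter> M" "D \<inter> R"] card_Un_le[of "D \<inter> L" "D \<inter> M"] by simp
  qed
  have cases3: "D \<subseteq> M \<union> R \<or> D \<subseteq> L \<union> M \<or> (\<exists>l r. l \<in> D \<and> l \<in> L \<and> r \<in> D \<and> r \<in> R)"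
    if "D \<subseteq> L \<union> M \<union> R" for D
    using that by blast
  have "chains_le (-1) (m + 1) (L \<union> M \<union> R)"
    unfolding chains_le_def
  proof (intro allI impI)
    fix D assume D: "D \<subseteq> L \<union> M \<union> R" "turning (-1) D"
    have neg: "ori a b c < 0" if "a \<in> D" "b \<in> D" "c \<in> D" "a$1 < b$1" "b$1 < c$1" for a b c
      using D(2) that by (auto simp: turning_def)
    show "card D \<le> m + 1"
    proof (cases "\<exists>l r. l \<in> D \<and> l \<in> L \<and> r \<in> D \<and> r \<in> R")
      case False
      then show ?thesis
        using cases3[OF D(1)] D(2) capMR capLM unfolding chains_le_def by blast
    next
      case True
      then obtain l r where lr: "l \<in> D" "l \<in> L" "r \<in> D" "r \<in> R" by blast
      \<comment> \<open>Two points of \<open>L\<close> before \<open>r\<close>, or two of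
        \<open>R\<close> after \<open>l\<close>, would turn left. Adding the \<open>m - 1\<close>
        points visible from \<open>r\<close> gives \<open>m + 1\<close>.\<close>
      have "card (D \<inter> L) \<le> 1"
      proof (rule card_le_1I)
        show False if "a \<in> D \<inter> L" "b \<in> D \<inter> L" "a$1 < b$1" for a b
          using that lr llt[of a b r] neg[of a b r] xLT[of b r] by force
      qed (use fL generic_subset[OF genL] in auto)
      moreover have "card (D \<inter> R) \<le> 1"
      proof (rule card_le_1I)
        show False if "a \<in> D \<inter> R" "b \<in> D \<inter> R" "a$1 < b$1" for a b
          using that lr lrr[of l a b] neg[of l a b] xLT[of l a] by force
      qed (use fR generic_subset[OF genR] in auto)
      moreover have "card (D \<inter> M) \<le> m - 1"
        using lr xMR neg turning_subset[OF D(2)] by (intro visible[of _ r]) auto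
      ultimately show ?thesis using split3[OF D(1)] m by linarith
    qed
  qed
  moreover have "polygons_le (m + u + 2) (L \<union> M \<union> R)"
    unfolding polygons_le_def
  proof (intro allI impI)
    fix C assume C: "C \<subseteq> L \<union> M \<union> R" "no_point_in_triangle C"
    show "card C \<le> m + u + 2"
    proof (cases "\<exists>l r. l \<in> C \<and> l \<in> L \<and> r \<in> C \<and> r \<in> R")
      case False
      then show ?thesis
        using cases3[OF C(1)] C(2) polMR polLM unfolding polygons_le_def by blast
    next
      case True
      then obtain l r where lr: "l \<in> C" "l \<in> L" "r \<in> C" "r \<in> R" by blast
      \<comment> \<open>The parts in \<open>L\<close> and \<open>R\<close> are cups of at most
        \<open>u + 1\<close> and \<open>2\<close> points, and the part in \<open>M\<close> is a cap
        visible from \<open>r\<close>: together \<open>m + u + 2\<close>.\<close>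
      have "turning (- (-1)) (C \<inter> L)"
        by (rule flank_right[OF C(2) _ _ lr(3)])
          (use lr llt[of _ _ r] generic_subset[OF genL] in auto)
      then have "card (C \<inter> L) \<le> u + 1"
        using L(2) by (simp add: small_def chains_le_def)
      moreover have "turning 1 (C \<inter> R)"
        by (rule flank_left[OF C(2) _ _ lr(1)])
          (use lr lrr[of l] generic_subset[OF genR] in auto)
      then have "card (C \<inter> R) \<le> 2"
        using c by (simp add: crown_def chains_le_def)
      moreover have "card (C \<inter> M) \<le> m - 1"
      proof (rule visible[of _ r])
        show "turning (-1) (C \<inter> M)"
          by (rule flank_left[OF C(2) _ _ lr(1)])
            (use lr lzt[of l] generic_subset[OF genM] in auto)
        show "ori a b r < 0" if ab: "a \<in> C \<inter> M" "b \<in> C \<inter> M" "a$1 < b$1" for a b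
        proof (rule ccontr)
          \<comment> \<open>Otherwise \<open>b\<close> would lie inside the triangle
            \<open>l r a\<close>.\<close>
          assume "\<not> ori a b r < 0"
          moreover have "ori a b r \<noteq> 0"
            using gen ab lr xMR[of b r] unfolding generic_def by blast
          ultimately have "ori a b r > 0" by simp
          then have "ori b r a > 0" by (simp only: ori_cycle[of b r a])
          moreover have "ori l b a > 0"
            using lzt[of l a b] ab lr by (simp add: ori_def algebra_simps)
          moreover have "ori l r b > 0"
            using lzt[of l b r] ab lr xMR[of b r] by (simp add: ori_def algebra_simps)
          ultimately show False
            using C(2) ab lr unfolding no_point_in_triangle_def by blast
        qed
      qed (use lr in auto)
      ultimately show ?thesis using split3[OF C(1)] m by linarith
    qed
  qed
  moreover have "card (L \<union> M \<union> R) = ((m + u + 1) choose m) + 1"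
  proof -
    have "L \<inter> (M \<union> R) = {}" "M \<inter> R = {}" using xLT xMR by fastforce+
    then have "card (L \<union> (M \<union> R)) = card L + (card M + card R)"
      using fL fM fR by (simp add: card_Un_disjoint)
    moreover have "card M + card R = (card M + m) + 1" using c by (simp add: crown_def)
    moreover have "((m + u) choose m) + ((m + u) choose (m - 1)) = (m + u + 1) choose m"
      using m by (cases m) simp_all
    ultimately show ?thesis using c L(1) by (simp add: crown_def Un_assoc)
  qed
  moreover have "\<forall>l\<in>L. \<forall>z\<in>M. \<forall>r\<in>R. l$1 < z$1 \<and> z$1 < r$1 \<and> ori l z r < 0"
    using xLT xMR lzt by simp
  ultimately have "gadget m u L M R"
    using c gen cupMR cupLM fL fM fR by (simp add: gadget_def crown_def Un_assoc)
  then show ?thesis by blast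
qed

section \<open>The whole configuration\<close>

theorem mainTheorem4:
  fixes n :: nat
  assumes "n \<ge> 6"
  shows "\<exists>X :: (real^2) set. finite X \<and> general_position X \<and> card X \<ge> 2 ^ (n - 2) + 1 \<and>
           (\<forall>C. convex_ngon_in n X C \<longrightarrow>
              int (interior_points X C) >
                int ((n - 3) choose nat \<lceil>real (n - 3) / 2\<rceil>) - \<lceil>real n / 2\<rceil>)"
proof -
  \<comment> \<open>\<open>m\<close> is the index of the replaced cluster, \<open>N\<close> is the
    exponent \<open>n - 2\<close>, and \<open>u\<close> is chosen so that
    \<open>m + u = n - 3\<close>.\<close>
  define m u N where "m = (n - 1) div 2" and "u = n - m - 3" and "N = m + u + 1"
  have m: "m \<ge> 2" and n: "n = m + u + 3" and N: "n = N + 2"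
    using assms by (simp_all add: m_def u_def N_def)
  have half: "n = 2 * m + 1 \<or> n = 2 * m + 2" by (simp add: m_def) (use assms in presburger)
  \<comment> \<open>The right-hand side is \<open>card M - 1\<close>, so it suffices that all of
    \<open>M\<close> lies in the interior. For odd \<open>n\<close> the lower index is
    \<open>m - 1\<close> already; for even \<open>n\<close> it is \<open>m\<close>, and symmetry of
    the binomial coefficient helps.\<close>
  have bound: "int ((n - 3) choose nat \<lceil>real (n - 3) / 2\<rceil>) - \<lceil>real n / 2\<rceil>
      = int ((m + u) choose (m - 1)) - int (m + 1)"
    using half
  proof
    assume h: "n = 2 * m + 1"
    then have "real (n - 3) / 2 = real (m - 1)" using m by (simp add: of_nat_diff field_simps)
    then have "\<lceil>real (n - 3) / 2\<rceil> = int (m - 1)" by (simp only: ceiling_of_nat)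
    moreover have "\<lceil>real n / 2\<rceil> = int (m + 1)"
      using h by (auto simp: ceiling_eq_iff field_simps)
    ultimately show ?thesis using n by simp
  next
    assume h: "n = 2 * m + 2"
    then have "\<lceil>real (n - 3) / 2\<rceil> = int m" "\<lceil>real n / 2\<rceil> = int (m + 1)"
      using m by (auto simp: ceiling_eq_iff field_simps of_nat_diff)
    moreover have "(m + u) choose m = (m + u) choose (m - 1)"
    proof -
      have "m - 1 = m + u - m" using h n by simp
      then show ?thesis using binomial_symmetric[of m "m + u"] by (simp only: le_add1)
    qed
    ultimately show ?thesis using n by simp
  qed

  \<comment> \<open>Assembly of the point set\<close>
  obtain L M R where g: "gadget m u L M R" using gadget_exists[OF m] by blast
  define Y where "Y = L \<union> M \<union> R"
  have Y: "finite Y" "generic Y" "card Y = (N choose m) + 1"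
    "chains_le (-1) (m + 1) Y" "polygons_le (N + 1) Y"
    using g by (simp_all add: gadget_def Y_def N_def)
  have cups0: "chains_le 1 (N - m + 1) (M \<union> R)" "chains_le 1 (N - m + 1) (L \<union> M)"
    using g by (simp_all add: gadget_def N_def)
  \<comment> \<open>The clusters to the right of the enlarged one, built up from the empty set,
    whose cup bound is 0.\<close>
  obtain G where G: "finite G" "card G = (\<Sum>t=m+1..<N+1. N choose t)" "generic G"
    "chains_le 1 (N - m) G" "polygons_le (N + 1) G"
    using erdos_szekeres_extension[of "{}" "m + 1" "N + 1" N]
    by (auto simp: N_def generic_def chains_le_def polygons_le_def)
  obtain v where "join 1 ((\<lambda>p. p + v) ` Y) G"
    using join_translation[OF Y(1) G(1), of 1] by blast
  \<comment> \<open>\<open>G\<close> is moved instead of \<open>Y\<close>, so that the facts about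
    \<open>L\<close>, \<open>M\<close> and \<open>R\<close> persist.\<close>
  then have j: "join 1 Y ((\<lambda>p. p + - v) ` G)" by (rule join_translate_back)
  define H where "H = (\<lambda>p. p + - v) ` G"
  note j = j[folded H_def]
  \<comment> \<open>\<open>card G\<close> is the trivial cap bound; it completes the data that
    \<open>small_image\<close> transports.\<close>
  have "small (card G) (N - m) (N + 1) G"
    using G(1,3-5) by (simp add: small_def chains_le_def card_mono)
  then have "small (card G) (N - m) (N + 1) H"
    unfolding H_def by (rule small_image[OF order_embedding_translation])
  then have H: "finite H" "generic H" "chains_le 1 (N - m) H" "polygons_le (N + 1) H"
    unfolding small_def by simp_all
  have cardH: "card H = (\<Sum>t=m+1..<N+1. N choose t)"
    unfolding H_def card_translation by (rule G(2))
  have genB: "generic (Y \<union> H)" using Y H j by (intro generic_join)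
  have fB: "finite (Y \<union> H)" using Y H by simp
  obtain U where U: "finite U" "card U = (\<Sum>t=0..<m. N choose t)" "generic (U \<union> (Y \<union> H))"
    "\<forall>p\<in>U. \<forall>b\<in>Y \<union> H. p$1 < b$1"
    "\<forall>p\<in>U. \<forall>b\<in>Y \<union> H. \<forall>b'\<in>Y \<union> H. b$1 < b'$1 \<longrightarrow> ori p b b' > 0"
    and ext: "\<forall>B'\<subseteq>Y \<union> H. chains_le 1 (N + 1 - m) B' \<longrightarrow> polygons_le (N + 1) B' \<longrightarrow>
       chains_le 1 (N + 1 - 0) (U \<union> B') \<and> polygons_le (N + 1) (U \<union> B')"
    using erdos_szekeres_extension[OF fB genB, of 0 m N] N_def by auto
  define X where "X = U \<union> (Y \<union> H)"
  \<comment> \<open>A cap of at most \<open>m + 1\<close> points in \<open>Y'\<close> and a cup of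
    at most \<open>N - m\<close> in \<open>H\<close>. With all of \<open>Y\<close> for
    \<open>Y'\<close>, this forces an n-gon to meet \<open>U\<close>.\<close>
  have polB: "polygons_le (N + 1) (Y' \<union> H)" if "Y' \<subseteq> Y" for Y'
  proof (rule polygons_le_join[of 1 _ _ _ "m + 1" "N - m"])
    show "join 1 Y' H" using j by (rule join_subset) (use that in auto)
    show "generic Y'" using Y(2) that by (rule generic_subset)
    show "polygons_le (N + 1) Y'" using Y(5) that by (rule polygons_le_subset) simp
    show "chains_le (- 1) (m + 1) Y'" using Y(4) that by (rule chains_le_subset) simp
  qed (use H N_def in auto)
  \<comment> \<open>To be applied to \<open>M \<union> R\<close> and \<open>L \<union> M\<close>,
    which obey the cup bound of the replaced cluster.\<close>
  have polX: "polygons_le (N + 1) (U \<union> (Y' \<union> H))"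
    if "Y' \<subseteq> Y" "chains_le 1 (N - m + 1) Y'" for Y'
  proof -
    have "chains_le 1 (N + 1 - m) (Y' \<union> H)"
    proof (rule chains_le_join_right)
      show "join 1 Y' H" using j by (rule join_subset) (use that in auto)
      show "generic Y'" using Y(2) that(1) by (rule generic_subset)
      show "finite Y'" using Y(1) that(1) by (rule finite_subset[rotated])
      show "chains_le 1 (N - m + 1) Y'" by (rule that(2))
    qed (use H N_def in auto)
    moreover have "Y' \<union> H \<subseteq> Y \<union> H" using that by blast
    ultimately show ?thesis using ext polB[OF that(1)] by blast
  qed
  have "finite X" using U(1) fB by (simp add: X_def)
  moreover have "general_position X"
    using U(3) unfolding X_def by (rule generic_imp_general_position)
  moreover have "card X = 2 ^ (n - 2) + 1"
  proof -
    have "U \<inter> (Y \<union> H) = {}" using U(4) by fastforce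
    then have "card X = card U + (card Y + card H)"
      using U(1) Y(1) H(1) join_disjoint[OF j] by (simp add: X_def card_Un_disjoint)
    also have "\<dots> = ((\<Sum>t=0..<m. N choose t) + ((N choose m) + (\<Sum>t=m+1..<N+1. N choose t))) + 1"
      unfolding U(2) Y(3) cardH by simp
    also have "(N choose m) + (\<Sum>t=m+1..<N+1. N choose t) = (\<Sum>t=m..<N+1. N choose t)"
      using sum.atLeast_Suc_lessThan[of m "N + 1" "\<lambda>t. N choose t"] N_def by simp
    also have "(\<Sum>t=0..<m. N choose t) + (\<Sum>t=m..<N+1. N choose t) = (\<Sum>t=0..<N+1. N choose t)"
      using N_def by (intro sum.atLeastLessThan_concat) simp_all
    also have "(\<Sum>t=0..<N+1. N choose t) = 2 ^ N"
      using choose_row_sum[of N] by (simp add: atLeast0LessThan lessThan_Suc_atMost)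
    finally show ?thesis by (simp add: N)
  qed

  \<comment> \<open>Interior points of a convex n-gon\<close>
  moreover have "int (interior_points X C) > int ((m + u) choose (m - 1)) - int (m + 1)"
    if "convex_ngon_in n X C" for C
  proof -
    have C: "C \<subseteq> X" "card C = N + 2" "convex_position C"
      using that N by (simp_all add: convex_ngon_in_def)
    have tf: "no_point_in_triangle C"
      using C(3) by (rule convex_position_imp_no_point_in_triangle)
    have big: "\<not> C \<subseteq> S" if "polygons_le (N + 1) S" for S
    proof
      assume "C \<subseteq> S"
      then have "card C \<le> N + 1" using that tf unfolding polygons_le_def by blast
      then show False using C(2) by simp
    qed
    \<comment> \<open>An n-gon has \<open>N + 2\<close> points, too many for a set that omits
      \<open>L\<close>, \<open>R\<close> or \<open>U\<close>; hence it meets all three.\<close>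
    have "M \<union> R \<subseteq> Y" "L \<union> M \<subseteq> Y" by (auto simp: Y_def)
    then have "\<not> C \<subseteq> U \<union> ((M \<union> R) \<union> H)" "\<not> C \<subseteq> U \<union> ((L \<union> M) \<union> H)"
      using big polX cups0 by simp_all
    moreover have "\<not> C \<subseteq> Y \<union> H" using big polB by simp
    ultimately obtain p l r where plr: "p \<in> C" "p \<in> U" "l \<in> C" "l \<in> L" "r \<in> C" "r \<in> R"
      using C(1) unfolding X_def Y_def by blast
    have "z \<in> interior (convex hull C)" if z: "z \<in> M" for z
    proof -
      have lzr: "l$1 < z$1" "z$1 < r$1" "ori l z r < 0"
        using g plr z by (simp_all add: gadget_def)
      have "l \<in> Y \<union> H" "z \<in> Y \<union> H" "r \<in> Y \<union> H" using plr z by (auto simp: Y_def)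
      then have "ori p z r > 0" "ori p l z > 0" using U(5) plr(2) lzr by blast+
      moreover have "ori z l r > 0" using lzr(3) ori_swap[of l z r] by simp
      ultimately have "z \<in> interior (convex hull {p, l, r})" by (intro in_interior_triangle)
      moreover have "convex hull {p, l, r} \<subseteq> convex hull C"
        using plr by (intro hull_mono) auto
      ultimately show ?thesis using interior_mono by blast
    qed
    then have "M \<subseteq> X \<inter> interior (convex hull C)" by (auto simp: X_def Y_def)
    then have "card M \<le> interior_points X C"
      unfolding interior_points_def using \<open>finite X\<close> by (intro card_mono) auto
    moreover have "card M + m = (m + u) choose (m - 1)" using g by (simp add: gadget_def)
    ultimately show ?thesis by linarith
  qed
  ultimately show ?thesis unfolding bound by (intro exI[of _ X]) simp
qed

end
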